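(* Let $N\ge 2$ and $m\ge 1$ be integers and let $x^{(r,s)}_k$ ($1\le r,s\le N$, $1\le k\le m$) be elements of a commutative ring; set $x^{(r,s)}_{m+1}=0$ for all $1\le r,s\le N$. Let $D(N,m)$ be the $Nm\times Nm$ matrix which, as an $N\times N$ block matrix with $m\times m$ blocks, has $(r,s)$ block $D_m(x^{(r,s)}_1,\dots,x^{(r,s)}_m)$. Then $$\det(D(N,m))=\begin{cases}(-1)^{\frac{Nm}{2}}\prod_{i=1}^{m}\det(X_{(i,i+1)}), & \text{if } m \text{ is even},\\[2pt] (-1)^{\frac{N(m-1)}{2}}\prod_{i=1}^{m}\det(X_{(i,i+1)}), & \text{if } m \text{ is odd}.\end{cases}$$
   Context: For elements $x_1,\dots,x_m$, $D_m(x_1,\dots,x_m)$ is the $m\times m$ matrix whose $(p,q)$ entry is $x_{\max(m+1-p,\,q)}$ (bottom-left entry $x_1$, first row and last column constantly $x_m$). For $1\le i\le m$, $X_{(i,i+1)}$ is the $N\times N$ matrix whose $(r,s)$ entry is $x^{(r,s)}_i-x^{(r,s)}_{i+1}$. *)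

theory Defs
  imports "Jordan_Normal_Form.Determinant"
begin

text \<open>
  Families of ring elements and block positions are numbered from 1; the rows and columns of the
  type \<open>mat\<close> are numbered from 0. Position \<open>(i, j)\<close> of a matrix thus stands for row \<open>i + 1\<close> and
  column \<open>j + 1\<close> in the usual numbering.
\<close>

definition D_block :: "nat \<Rightarrow> (nat \<Rightarrow> 'a) \<Rightarrow> 'a mat" where
  "D_block m y = mat m m (\<lambda>(i, j). let p = i + 1; q = j + 1 in y (max (m + 1 - p) q))"

text \<open>
  The argument \<open>x r s k\<close> below is the element \<open>x\<^sub>k\<close> with superscript \<open>(r, s)\<close>.
  Row \<open>i\<close> of the large matrix is row \<open>i mod m\<close> of block row \<open>i div m + 1\<close>; likewise for columns.
\<close>

definition D_mat :: "nat \<Rightarrow> nat \<Rightarrow> (nat \<Rightarrow> nat \<Rightarrow> nat \<Rightarrow> 'a) \<Rightarrow> 'a mat" where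
  "D_mat N m x = mat (N * m) (N * m)
     (\<lambda>(i, j). D_block m (x (i div m + 1) (j div m + 1)) $$ (i mod m, j mod m))"

definition X_mat :: "nat \<Rightarrow> (nat \<Rightarrow> nat \<Rightarrow> nat \<Rightarrow> 'a::comm_ring_1) \<Rightarrow> nat \<Rightarrow> 'a mat" where
  "X_mat N x k = mat N N
     (\<lambda>(i, j). let r = i + 1; s = j + 1 in x r s k - x r s (k + 1))"

end

theory Submission
  imports Defs
begin

text \<open>
  With \<open>W\<close> the 0/1 matrix that is 1 on and below the anti-diagonal and \<open>U\<close> the lower triangular
  matrix of ones, telescoping \<open>x\<^sub>c = (x\<^sub>c - x\<^sub>c\<^sub>+\<^sub>1) + \<dots> + (x\<^sub>m - x\<^sub>m\<^sub>+\<^sub>1)\<close> gives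
  \<open>D\<^sub>m = W \<cdot> diag (x\<^sub>k - x\<^sub>k\<^sub>+\<^sub>1) \<cdot> U\<close>. The factors \<open>W\<close> and \<open>U\<close> do not depend on the entries,
  so applied blockwise this factors \<open>D(N,m)\<close> as well. Its middle factor, whose blocks are diagonal,
  becomes the block diagonal matrix of the \<open>X\<^sub>(\<^sub>k\<^sub>,\<^sub>k\<^sub>+\<^sub>1\<^sub>)\<close> when rows and columns are permuted
  simultaneously. The sign is \<open>det W\<close> to the power \<open>N\<close>.
\<close>

section \<open>Determinants of block diagonal matrices over a commutative ring\<close>

text \<open>Peeling the last row and column off the identity reduces this to expansion with a 1 by 1
  corner block.\<close>

lemma det_four_block_mat_one_right:
  fixes A :: "'a :: comm_ring_1 mat"
  assumes A: "A \<in> carrier_mat n n"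
  shows "det (four_block_mat A (0\<^sub>m n k) (0\<^sub>m k n) (1\<^sub>m k)) = det A"
proof (induction k)
  case 0
  have "four_block_mat A (0\<^sub>m n 0) (0\<^sub>m 0 n) (1\<^sub>m 0) = A"
    by (rule eq_matI) (use A in auto)
  then show ?case by simp
next
  case (Suc k)
  let ?B = "four_block_mat A (0\<^sub>m n k) (0\<^sub>m k n) (1\<^sub>m k)"
  have "four_block_mat A (0\<^sub>m n (Suc k)) (0\<^sub>m (Suc k) n) (1\<^sub>m (Suc k))
      = four_block_mat ?B (0\<^sub>m (n + k) 1) (0\<^sub>m 1 (n + k)) (1\<^sub>m 1)"
    by (rule eq_matI) (use A in auto)
  also have "det \<dots> = det ?B * det (1\<^sub>m 1 :: 'a mat)"
    by (rule det_four_block_mat_upper_right_zero_col) (use A in auto)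
  finally show ?case using Suc.IH by simp
qed

lemma det_four_block_mat_one_left:
  fixes A :: "'a :: comm_ring_1 mat"
  assumes A: "A \<in> carrier_mat n n"
  shows "det (four_block_mat (1\<^sub>m k) (0\<^sub>m k n) (0\<^sub>m n k) A) = det A"
proof (induction k)
  case 0
  have "four_block_mat (1\<^sub>m 0) (0\<^sub>m 0 n) (0\<^sub>m n 0) A = A"
    by (rule eq_matI) (use A in auto)
  then show ?case by simp
next
  case (Suc k)
  let ?B = "four_block_mat (1\<^sub>m k) (0\<^sub>m k n) (0\<^sub>m n k) A"
  have "four_block_mat (1\<^sub>m (Suc k)) (0\<^sub>m (Suc k) n) (0\<^sub>m n (Suc k)) A
      = four_block_mat (1\<^sub>m 1) (0\<^sub>m 1 (k + n)) (0\<^sub>m (k + n) 1) ?B"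
    by (rule eq_matI) (use A in \<open>auto simp: less_Suc_eq_le\<close>)
  also have "det \<dots> = det (1\<^sub>m 1 :: 'a mat) * det ?B"
    by (rule det_four_block_mat_lower_left_zero_col) (use A in auto)
  finally show ?case using Suc.IH by simp
qed

text \<open>The library's determinants of block triangular matrices need an integral domain.\<close>

lemma det_four_block_mat_diag:
  fixes A B :: "'a :: comm_ring_1 mat"
  assumes A: "A \<in> carrier_mat n n" and B: "B \<in> carrier_mat k k"
  shows "det (four_block_mat A (0\<^sub>m n k) (0\<^sub>m k n) B) = det A * det B"
proof -
  let ?A = "four_block_mat A (0\<^sub>m n k) (0\<^sub>m k n) (1\<^sub>m k)"
  let ?B = "four_block_mat (1\<^sub>m n) (0\<^sub>m n k) (0\<^sub>m k n) B"
  \<comment> \<open>diag(A, B) = diag(A, 1) diag(1, B), so multiplicativity of \<open>det\<close>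
    replaces any division argument.\<close>
  have "?A * ?B = four_block_mat A (0\<^sub>m n k) (0\<^sub>m k n) B"
    by (subst mult_four_block_mat[of _ n n _ k _ k _ _ n _ k]) (use A B in auto)
  moreover have "det (?A * ?B) = det ?A * det ?B"
    by (rule det_mult[of _ "n + k"]) (use A B in auto)
  ultimately show ?thesis
    using det_four_block_mat_one_right[OF A] det_four_block_mat_one_left[OF B] by simp
qed

text \<open>Indices are split by \<open>div\<close> and \<open>mod\<close> exactly as in
  \<open>D_mat\<close>, so that products can be compared with it entry by entry.\<close>

definition block_diag :: "nat \<Rightarrow> nat \<Rightarrow> (nat \<Rightarrow> 'a::zero mat) \<Rightarrow> 'a mat" where
  "block_diag n m F = mat (n * m) (n * m)
     (\<lambda>(i, j). if i div m = j div m then F (i div m) $$ (i mod m, j mod m) else 0)"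

lemma block_diag_carrier [simp]: "block_diag n m F \<in> carrier_mat (n * m) (n * m)"
  by (simp add: block_diag_def)

lemma index_block_diag:
  "i < n * m \<Longrightarrow> j < n * m \<Longrightarrow> block_diag n m F $$ (i, j)
    = (if i div m = j div m then F (i div m) $$ (i mod m, j mod m) else 0)"
  by (simp add: block_diag_def)

lemma det_block_diag:
  fixes F :: "nat \<Rightarrow> 'a :: comm_ring_1 mat"
  assumes F: "\<And>k. k < n \<Longrightarrow> F k \<in> carrier_mat m m"
  shows "det (block_diag n m F) = (\<Prod>k<n. det (F k))"
  using F
proof (induction n)
  case 0
  then show ?case by (simp add: block_diag_def)
next
  case (Suc n)
  have "block_diag (Suc n) m F
      = four_block_mat (block_diag n m F) (0\<^sub>m (n * m) m) (0\<^sub>m m (n * m)) (F n)"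
    (is "?L = ?R")
  proof (rule eq_matI)
    have Fn: "F n \<in> carrier_mat m m" using Suc.prems by simp
    fix i j assume "i < dim_row ?R" "j < dim_col ?R"
    then have ij: "i < n * m + m" "j < n * m + m" using Fn by (auto simp: block_diag_def)
    \<comment> \<open>The indices from \<open>n * m\<close> on are those of the last block, at
      offset \<open>a - n * m\<close>.\<close>
    have div: "a div m < n \<longleftrightarrow> a < n * m" "\<not> a < n * m \<Longrightarrow> a div m = n \<and> a mod m = a - n * m"
      if "a < n * m + m" for a
    proof -
      have m: "m > 0" using that by (cases m) auto
      then show "a div m < n \<longleftrightarrow> a < n * m" by (simp add: div_less_iff_less_mult)
      assume "\<not> a < n * m"
      then obtain c where c: "a = n * m + c" using le_Suc_ex[of "n * m" a] by auto
      moreover have "c < m" using c that by simp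
      ultimately show "a div m = n \<and> a mod m = a - n * m" by simp
    qed
    have L: "?L $$ (i, j)
        = (if i div m = j div m then F (i div m) $$ (i mod m, j mod m) else 0)"
      by (rule index_block_diag) (use ij in auto)
    have dim: "dim_row (block_diag n m F) = n * m" "dim_col (block_diag n m F) = n * m"
      by (simp_all add: block_diag_def)
    have R: "?R $$ (i, j) = (if i < n * m
        then if j < n * m then block_diag n m F $$ (i, j) else 0
        else if j < n * m then 0 else F n $$ (i - n * m, j - n * m))"
      using ij Fn by (simp add: dim)
    show "?L $$ (i, j) = ?R $$ (i, j)"
    proof (cases "i < n * m"; cases "j < n * m")
      assume "i < n * m" "j < n * m"
      then show ?thesis unfolding L R by (simp add: index_block_diag)
    next
      assume "i < n * m" "\<not> j < n * m"
      then show ?thesis unfolding L R using div(1)[OF ij(1)] div(2)[OF ij(2)] by simp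
    next
      assume "\<not> i < n * m" "j < n * m"
      then show ?thesis unfolding L R using div(2)[OF ij(1)] div(1)[OF ij(2)] by simp
    next
      assume "\<not> i < n * m" "\<not> j < n * m"
      then show ?thesis unfolding L R using div(2)[OF ij(1)] div(2)[OF ij(2)] by simp
    qed
  qed (use Suc.prems[of n] in \<open>auto simp: block_diag_def\<close>)
  then show ?case using Suc det_four_block_mat_diag[OF block_diag_carrier, of "F n" m n m F] by simp
qed

section \<open>Simultaneous permutation of rows and columns\<close>

text \<open>The sign of \<open>p\<close> arises twice, once from the rows and once, after
  transposing, from the columns; its square is 1.\<close>

lemma det_permute_rows_cols:
  fixes A :: "'a :: comm_ring_1 mat"
  assumes A: "A \<in> carrier_mat n n" and p: "p permutes {0..<n}"
  shows "det (mat n n (\<lambda>(i, j). A $$ (p i, p j))) = det A"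
proof -
  let ?B = "mat n n (\<lambda>(i, j). A $$ (p i, j))"
  have pl: "p i < n" if "i < n" for i using permutes_in_image[OF p, of i] that by simp
  have "mat n n (\<lambda>(i, j). A $$ (p i, p j))
      = transpose_mat (mat n n (\<lambda>(i, j). transpose_mat ?B $$ (p i, j)))"
    by (rule eq_matI) (auto simp: pl)
  then have "det (mat n n (\<lambda>(i, j). A $$ (p i, p j)))
      = det (mat n n (\<lambda>(i, j). transpose_mat ?B $$ (p i, j)))"
    by (simp add: det_transpose[of _ n])
  also have "\<dots> = signof p * det (transpose_mat ?B)"
    by (rule det_permute_rows) (use p in auto)
  also have "\<dots> = signof p * (signof p * det A)"
    by (simp add: det_transpose[of _ n] det_permute_rows[OF A p])
  also have "\<dots> = det A" by (simp add: sign_def)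
  finally show ?thesis .
qed

text \<open>Each \<open>k < n * m\<close> is uniquely \<open>r * m + a\<close> with
  \<open>a < m\<close>; the range is cut into \<open>n\<close> runs of length
  \<open>m\<close>.\<close>

lemma sum_div_mod:
  fixes g :: "nat \<Rightarrow> nat \<Rightarrow> 'a :: comm_monoid_add"
  shows "(\<Sum>k<n * m. g (k div m) (k mod m)) = (\<Sum>r<n. \<Sum>a<m. g r a)"
proof -
  have "(\<Sum>k<n * m. g (k div m) (k mod m))
      = (\<Sum>r<n. \<Sum>k = r * m..<r * m + m. g (k div m) (k mod m))"
    by (rule sum.nat_group[symmetric])
  also have "\<dots> = (\<Sum>r<n. \<Sum>a<m. g r a)"
  proof (rule sum.cong)
    fix r
    have "(\<Sum>k = r * m..<r * m + m. g (k div m) (k mod m))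
        = (\<Sum>a = 0..<m. g ((a + r * m) div m) ((a + r * m) mod m))"
      using sum.shift_bounds_nat_ivl[of "\<lambda>k. g (k div m) (k mod m)" 0 "r * m" m]
      by (simp add: add.commute)
    also have "\<dots> = (\<Sum>a<m. g r a)"
      by (rule sum.cong) (auto simp: lessThan_atLeast0)
    finally show "(\<Sum>k = r * m..<r * m + m. g (k div m) (k mod m)) = (\<Sum>a<m. g r a)" .
  qed simp
  finally show ?thesis .
qed

text \<open>An \<open>n \<times> n\<close> block matrix with diagonal \<open>m \<times> m\<close> blocks; \<open>F k\<close> collects the \<open>k\<close>-th diagonal entries.\<close>

definition stride_mat :: "nat \<Rightarrow> nat \<Rightarrow> (nat \<Rightarrow> 'a::zero mat) \<Rightarrow> 'a mat" where
  "stride_mat n m F = mat (n * m) (n * m)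
     (\<lambda>(i, j). if i mod m = j mod m then F (i mod m) $$ (i div m, j div m) else 0)"

lemma stride_mat_carrier [simp]: "stride_mat n m F \<in> carrier_mat (n * m) (n * m)"
  by (simp add: stride_mat_def)

lemma det_stride_mat:
  fixes F :: "nat \<Rightarrow> 'a :: comm_ring_1 mat"
  assumes F: "\<And>k. k < m \<Longrightarrow> F k \<in> carrier_mat n n"
  shows "det (stride_mat n m F) = (\<Prod>k<m. det (F k))"
proof -
  \<comment> \<open>\<open>p\<close> sends \<open>r * m + a\<close> to \<open>a * n + r\<close>,
    exchanging block number and position in the block. It is the identity elsewhere, as
    \<open>permutes\<close> demands.\<close>
  define p where "p i = (if i < n * m then (i mod m) * n + i div m else i)" for i
  have div: "i div m < n" "i mod m < m" if "i < n * m" for i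
    using that by (auto simp: less_mult_imp_div_less intro!: mod_less_divisor gr0I)
  have pdiv: "p i div n = i mod m" "p i mod n = i div m" if "i < n * m" for i
    using div[OF that] that by (auto simp: p_def)
  have pless: "p i < n * m" if "i < n * m" for i
  proof -
    have "(i mod m) * n + i div m < (i mod m) * n + n" using div[OF that] by simp
    also have "\<dots> = Suc (i mod m) * n" by simp
    also have "\<dots> \<le> m * n" using div[OF that] by (intro mult_le_mono1) simp
    finally show ?thesis using that by (simp add: p_def mult.commute)
  qed
  have "inj_on p {0..<n * m}"
  proof (rule inj_onI)
    fix i j assume "i \<in> {0..<n * m}" "j \<in> {0..<n * m}" "p i = p j"
    then have "i mod m = j mod m" "i div m = j div m" by (metis atLeastLessThan_iff pdiv)+
    then show "i = j" by (metis div_mult_mod_eq)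
  qed
  moreover have "p ` {0..<n * m} \<subseteq> {0..<n * m}" using pless by auto
  ultimately have "bij_betw p {0..<n * m} {0..<n * m}"
    by (simp add: bij_betw_def endo_inj_surj)
  then have perm: "p permutes {0..<n * m}"
    by (rule bij_imp_permutes) (auto simp: p_def)
  have B: "block_diag m n F \<in> carrier_mat (n * m) (n * m)"
    using block_diag_carrier[of m n F] by (simp add: mult.commute)
  have "stride_mat n m F = mat (n * m) (n * m) (\<lambda>(i, j). block_diag m n F $$ (p i, p j))"
    by (rule eq_matI)
      (auto simp: stride_mat_def block_diag_def pdiv pless mult.commute[of m n])
  then show ?thesis
    using det_permute_rows_cols[OF B perm] det_block_diag[of m F n] F by simp
qed

section \<open>Determinants of the constant factors W and U\<close>

text \<open>The first row has its only nonzero entry in the last column. Deleting both leaves the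
  same matrix one size smaller, so the cofactor signs multiply up to exponent 0 + 1 + ... + (m -
  1).\<close>

lemma det_anti_triangular_ones:
  "det (mat m m (\<lambda>(i, j). if m \<le> Suc (i + j) then 1 else 0) :: 'a :: comm_ring_1 mat)
    = (- 1) ^ (m * (m - 1) div 2)"
proof (induction m)
  case 0
  show ?case by simp
next
  case (Suc m)
  let ?W = "\<lambda>m. mat m m (\<lambda>(i, j). if m \<le> Suc (i + j) then 1 else 0) :: 'a mat"
  have "det (?W (Suc m)) = (\<Sum>j<Suc m. ?W (Suc m) $$ (0, j) * cofactor (?W (Suc m)) 0 j)"
    by (rule laplace_expansion_row) auto
  also have "\<dots> = cofactor (?W (Suc m)) 0 m" by simp
  also have "\<dots> = (- 1) ^ m * det (?W m)"
  proof -
    have "mat_delete (?W (Suc m)) 0 m = ?W m"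
      by (rule eq_matI) (auto simp: mat_delete_def)
    then show ?thesis by (simp add: cofactor_def)
  qed
  also have "\<dots> = (- 1) ^ (m + m * (m - 1) div 2)" using Suc by (simp add: power_add)
  also have "m + m * (m - 1) div 2 = Suc m * (Suc m - 1) div 2"
    by (cases m) (simp_all add: algebra_simps)
  finally show ?case .
qed

lemma det_lower_triangular_ones:
  "det (mat m m (\<lambda>(i, j). if j \<le> i then 1 else 0) :: 'a :: comm_ring_1 mat) = 1"
  by (subst det_lower_triangular[of m]) (auto simp: prod_list_diag_prod)

section \<open>The blockwise factorization of D(N,m)\<close>

text \<open>The outer factors link only indices of the same block and the middle one only equal
  positions within blocks, so of both summations just one over positions \<open>a\<close>
  survives.\<close>

lemma index_block_diag_stride_block_diag:
  fixes A B :: "'a :: comm_ring_1 mat"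
  assumes A: "A \<in> carrier_mat m m" and B: "B \<in> carrier_mat m m"
    and i: "i < n * m" and j: "j < n * m"
  shows "(block_diag n m (\<lambda>_. A) * stride_mat n m F * block_diag n m (\<lambda>_. B)) $$ (i, j)
    = (\<Sum>a<m. A $$ (i mod m, a) * F a $$ (i div m, j div m) * B $$ (a, j mod m))"
proof -
  have div: "i div m < n" "i mod m < m" if "i < n * m" for i
    using that by (auto simp: less_mult_imp_div_less intro!: mod_less_divisor gr0I)
  have left: "(block_diag n m (\<lambda>_. A) * stride_mat n m F) $$ (i, l)
      = A $$ (i mod m, l mod m) * F (l mod m) $$ (i div m, l div m)" if l: "l < n * m" for l
  proof -
    have "(block_diag n m (\<lambda>_. A) * stride_mat n m F) $$ (i, l)
      = (\<Sum>k<n * m. block_diag n m (\<lambda>_. A) $$ (i, k) * stride_mat n m F $$ (k, l))"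
      using i l by (auto simp: times_mat_def scalar_prod_def lessThan_atLeast0
          block_diag_def stride_mat_def)
    \<comment> \<open>Written through \<open>k div m\<close> and \<open>k mod m\<close> alone, the
      sum has the shape that \<open>sum_div_mod\<close> turns into a double sum.\<close>
    also have "\<dots> = (\<Sum>k<n * m. (if k div m = i div m then
        if k mod m = l mod m then A $$ (i mod m, k mod m) * F (k mod m) $$ (k div m, l div m)
        else 0 else 0))"
      by (rule sum.cong) (use i l in \<open>auto simp: block_diag_def stride_mat_def\<close>)
    also have "\<dots> = (\<Sum>r<n. \<Sum>a<m. if r = i div m then
        if a = l mod m then A $$ (i mod m, a) * F a $$ (r, l div m) else 0 else 0)"
      by (rule sum_div_mod)
    also have "\<dots> = (\<Sum>r<n. if r = i div m then (\<Sum>a<m.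
        if a = l mod m then A $$ (i mod m, a) * F a $$ (r, l div m) else 0) else 0)"
      by (rule sum.cong) auto
    finally show ?thesis using div[OF i] div[OF l] by simp
  qed
  have "(block_diag n m (\<lambda>_. A) * stride_mat n m F * block_diag n m (\<lambda>_. B)) $$ (i, j)
    = (\<Sum>l<n * m. (block_diag n m (\<lambda>_. A) * stride_mat n m F) $$ (i, l)
        * block_diag n m (\<lambda>_. B) $$ (l, j))"
    using i j by (subst index_mult_mat)
      (auto simp: scalar_prod_def lessThan_atLeast0 block_diag_def stride_mat_def simp del: index_mult_mat(1))
  also have "\<dots> = (\<Sum>l<n * m. if l div m = j div m then
      A $$ (i mod m, l mod m) * F (l mod m) $$ (i div m, l div m) * B $$ (l mod m, j mod m) else 0)"
    by (rule sum.cong) (use j in \<open>auto simp: left index_block_diag simp del: index_mult_mat(1)\<close>)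
  also have "\<dots> = (\<Sum>r<n. \<Sum>a<m. if r = j div m then
      A $$ (i mod m, a) * F a $$ (i div m, r) * B $$ (a, j mod m) else 0)"
    by (rule sum_div_mod)
  also have "\<dots> = (\<Sum>r<n. if r = j div m then
      \<Sum>a<m. A $$ (i mod m, a) * F a $$ (i div m, r) * B $$ (a, j mod m) else 0)"
    by (rule sum.cong) auto
  finally show ?thesis using div[OF j] by simp
qed

lemma D_mat_eq_product:
  fixes x :: "nat \<Rightarrow> nat \<Rightarrow> nat \<Rightarrow> 'a :: comm_ring_1"
  assumes x: "\<forall>r\<in>{1..N}. \<forall>s\<in>{1..N}. x r s (m + 1) = 0"
  shows "D_mat N m x =
    block_diag N m (\<lambda>_. mat m m (\<lambda>(i, j). if m \<le> Suc (i + j) then 1 else 0))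
    * stride_mat N m (\<lambda>k. X_mat N x (Suc k))
    * block_diag N m (\<lambda>_. mat m m (\<lambda>(i, j). if j \<le> i then 1 else 0))"
    (is "_ = block_diag N m (\<lambda>_. ?W) * ?S * block_diag N m (\<lambda>_. ?U)")
proof (rule eq_matI)
  fix i j
  assume "i < dim_row (block_diag N m (\<lambda>_. ?W) * ?S * block_diag N m (\<lambda>_. ?U))"
    and "j < dim_col (block_diag N m (\<lambda>_. ?W) * ?S * block_diag N m (\<lambda>_. ?U))"
  then have ij: "i < N * m" "j < N * m" by (auto simp: block_diag_def)
  have div: "i div m < N" "i mod m < m" if "i < N * m" for i
    using that by (auto simp: less_mult_imp_div_less intro!: mod_less_divisor gr0I)
  let ?y = "x (i div m + 1) (j div m + 1)"
  \<comment> \<open>The least \<open>a\<close> at which both row \<open>i mod m\<close> of W and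
    column \<open>j mod m\<close> of U are 1. Counted from 1, it is the index max(m + 1 - p, q) of
    \<open>D_block\<close>.\<close>
  let ?c = "max (m - Suc (i mod m)) (j mod m)"
  have c: "?c < m" using div(2)[OF ij(1)] div(2)[OF ij(2)] by auto
  have "(block_diag N m (\<lambda>_. ?W) * ?S * block_diag N m (\<lambda>_. ?U)) $$ (i, j)
      = (\<Sum>a<m. if ?c \<le> a then ?y (Suc a) - ?y (Suc (Suc a)) else 0)"
    by (subst index_block_diag_stride_block_diag[OF _ _ ij])
      (use div[OF ij(1)] div[OF ij(2)] in \<open>auto simp: X_mat_def intro!: sum.cong\<close>)
  also have "\<dots> = (\<Sum>a = ?c..<m. ?y (Suc a) - ?y (Suc (Suc a)))"
    by (rule sum.mono_neutral_cong_right) auto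
  \<comment> \<open>The differences descend, hence the negated sequence in the telescoping
    rule.\<close>
  also have "\<dots> = ?y (Suc ?c) - ?y (Suc m)"
    using sum_Suc_diff'[of ?c m "\<lambda>a. - ?y (Suc a)"] c by simp
  also have "\<dots> = ?y (Suc ?c)"
    using x div(1)[OF ij(1)] div(1)[OF ij(2)] by simp
  also have "Suc ?c = max (m + 1 - (i mod m + 1)) (j mod m + 1)"
    using div(2)[OF ij(1)] by auto
  finally show "D_mat N m x $$ (i, j)
      = (block_diag N m (\<lambda>_. ?W) * ?S * block_diag N m (\<lambda>_. ?U)) $$ (i, j)"
    using ij div[OF ij(1)] div[OF ij(2)] by (simp add: D_mat_def D_block_def Let_def)
qed (auto simp: D_mat_def block_diag_def)

theorem theorem2p4:
  fixes N m :: nat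
    and x :: "nat \<Rightarrow> nat \<Rightarrow> nat \<Rightarrow> 'a::comm_ring_1"
  assumes "N \<ge> 2"
    and "m \<ge> 1"
    and "\<forall>r\<in>{1..N}. \<forall>s\<in>{1..N}. x r s (m + 1) = 0"
  shows "det (D_mat N m x) =
    (if even m
     then (- 1) ^ (N * m div 2) * (\<Prod>i = 1..m. det (X_mat N x i))
     else (- 1) ^ (N * (m - 1) div 2) * (\<Prod>i = 1..m. det (X_mat N x i)))"
proof -
  let ?W = "mat m m (\<lambda>(i, j). if m \<le> Suc (i + j) then 1 else 0) :: 'a mat"
  let ?U = "mat m m (\<lambda>(i, j). if j \<le> i then 1 else 0) :: 'a mat"
  let ?S = "stride_mat N m (\<lambda>k. X_mat N x (Suc k))"
  have "det (D_mat N m x)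
      = det (block_diag N m (\<lambda>_. ?W)) * det ?S * det (block_diag N m (\<lambda>_. ?U))"
    unfolding D_mat_eq_product[of N x m, OF assms(3)]
    by (simp add: det_mult[of _ "N * m"] mult_carrier_mat[of _ "N * m" "N * m"])
  also have "det ?S = (\<Prod>k<m. det (X_mat N x (Suc k)))"
    by (rule det_stride_mat) (simp add: X_mat_def)
  also have "\<dots> = (\<Prod>i = 1..m. det (X_mat N x i))"
    by (rule prod.reindex_bij_witness[of _ "\<lambda>i. i - 1" Suc]) auto
  also have "det (block_diag N m (\<lambda>_. ?W)) = ((- 1) ^ (m * (m - 1) div 2)) ^ N"
    by (simp add: det_block_diag det_anti_triangular_ones)
  also have "det (block_diag N m (\<lambda>_. ?U)) = 1"
    by (simp add: det_block_diag det_lower_triangular_ones)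
  also have "((- 1 :: 'a) ^ (m * (m - 1) div 2)) ^ N
      = (if even m then (- 1) ^ (N * m div 2) else (- 1) ^ (N * (m - 1) div 2))"
  \<comment> \<open>The two exponents agree only modulo 2: they differ by the odd factor
    \<open>2 * k - 1\<close> or \<open>2 * k + 1\<close>.\<close>
  proof (cases "even m")
    case True
    then obtain k where k: "m = 2 * k" by blast
    then have "m * (m - 1) div 2 = k * (2 * k - 1)" "N * m div 2 = N * k" by auto
    \<comment> \<open>Here \<open>k > 0\<close> follows from \<open>m \<ge> 1\<close>, so the
      subtraction is not truncated.\<close>
    moreover have "odd (2 * k - 1)" using k assms(2) by simp
    ultimately show ?thesis using True
      by (simp flip: power_mult add: minus_one_power_iff)
  next
    case False
    then obtain k where k: "m = 2 * k + 1" using oddE by blast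
    then have "m * (m - 1) div 2 = (2 * k + 1) * k" "N * (m - 1) div 2 = N * k" by auto
    then show ?thesis using False
      by (simp flip: power_mult add: minus_one_power_iff)
  qed
  finally show ?thesis by simp
qed

end
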